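(* For given $Y\in\mathbb{R}^{M\times N}$ and $\mu>0$, the prox operator for the function $\mu g$ on $\mathbb{R}^{M\times N}$, where $g(X)=\|X\|_{1,2}$, has the closed form $$\operatorname{prox}_{\mu g}(Y):=\operatorname*{argmin}_{X\in\mathbb{R}^{M\times N}}\left(\mu g(X)+\frac12\|X-Y\|_F^2\right)=\mathbf{S}_{1,2}^\mu(Y),$$ where $\mathbf{S}_{1,2}^\mu$ is the soft thresholding operator acting on each row $\mathbf{y}_i\in\mathbb{R}^N$ of $Y$ by $$\mathbf{S}_{1,2}^\mu(\mathbf{y}_i):=\begin{cases}\dfrac{\|\mathbf{y}_i\|-\mu}{\|\mathbf{y}_i\|}\,\mathbf{y}_i,&\text{if }\|\mathbf{y}_i\|>\mu,\\[2mm]0,&\text{otherwise.}\end{cases}$$ In particular, if $Y\in\mathcal{M}_k$, then also $\operatorname{prox}_{\mu g}^{\mathcal{M}_k}(Y)=\mathbf{S}_{1,2}^\mu(Y)$.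
   Context: $M,N,k$ are positive integers, $\mathcal{M}_k=\{X\in\mathbb{R}^{M\times N}:\operatorname{rank}(X)\le k\}$, $\|\cdot\|$ is the Euclidean norm on $\mathbb{R}^N$, and $\|\cdot\|_F$ the Frobenius norm. The $(1,2)$-norm is $g(X)=\|X\|_{1,2}=\sum_{i=1}^M\|X(i,:)\|_2$, where $X(i,:)$ denotes the $i$-th row of $X$. The prox operator on $\mathcal{M}_k$ is defined by $$\operatorname{prox}_{\mu g}^{\mathcal{M}_k}(Y)\in\operatorname*{argmin}_{X\in\mathcal{M}_k}\left(\mu g(X)+\frac12\|X-Y\|_F^2\right).$$ *)

theory Defs
  imports "HOL-Analysis.Analysis"
begin

text \<open>
  An \<open>M \<times> N\<close> real matrix is an element of \<^typ>\<open>real^'n^'m\<close>, a vector of \<open>M = CARD('m)\<close> rows of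
  length \<open>N = CARD('n)\<close>. The library norm of this type is the Frobenius norm.
\<close>

lemma norm_matrix_eq_frobenius:
  fixes X :: "real^'n^'m"
  shows "norm X = sqrt (\<Sum>i\<in>UNIV. \<Sum>j\<in>UNIV. (X $ i $ j)\<^sup>2)"
  by (simp add: norm_vec_def L2_set_def sum_nonneg)

definition rank_le :: "nat \<Rightarrow> (real^'n^'m) set" where
  "rank_le k = {X. rank X \<le> k}"

definition norm12 :: "real^'n^'m \<Rightarrow> real" where
  "norm12 X = (\<Sum>i\<in>UNIV. norm (row i X))"

text \<open>
  The prox operator is kept set-valued: \<open>prox_on S f Y\<close> is the whole set of minimizers over \<open>S\<close>,
  so \<open>prox_on S f Y = {Z}\<close> says that \<open>Z\<close> is a minimizer and the only one, i.e. that
  every choice of a value of the prox operator at \<open>Y\<close> equals \<open>Z\<close>.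
\<close>

definition prox_on :: "(real^'n^'m) set \<Rightarrow> (real^'n^'m \<Rightarrow> real) \<Rightarrow> real^'n^'m \<Rightarrow> (real^'n^'m) set" where
  "prox_on S f Y = {X. is_arg_min (\<lambda>Z. f Z + 1/2 * (norm (Z - Y))\<^sup>2) (\<lambda>Z. Z \<in> S) X}"

definition soft_threshold_row :: "real \<Rightarrow> real^'n \<Rightarrow> real^'n" where
  "soft_threshold_row \<mu> y = (if norm y > \<mu> then ((norm y - \<mu>) / norm y) *\<^sub>R y else 0)"

definition soft_threshold :: "real \<Rightarrow> real^'n^'m \<Rightarrow> real^'n^'m" where
  "soft_threshold \<mu> Y = (\<chi> i. soft_threshold_row \<mu> (row i Y))"

end

theory Submission
  imports Defs
begin

text \<open>
  Both \<open>norm12\<close> and the squared Frobenius distance are sums over the rows, so the minimization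
  decouples into one problem per row: minimize \<open>\<mu> * norm x + 1/2 * (norm (x - y))\<^sup>2\<close>. For
  \<open>s = soft_threshold_row \<mu> y\<close> the residual \<open>y - s\<close> is a subgradient of \<open>\<mu> * norm\<close> at \<open>s\<close>, that is,
  \<open>norm (y - s) \<le> \<mu>\<close> and \<open>(y - s) \<bullet> s = \<mu> * norm s\<close>. Expanding the square around \<open>s\<close> then shows that
  the row objective at \<open>x\<close> exceeds its value at \<open>s\<close> by at least \<open>1/2 * (norm (x - s))\<^sup>2\<close>
  (\<open>row_objective_quadratic_growth\<close>). Summed over the rows, this quadratic growth gives
  minimality and uniqueness together, relative to any set of matrices that contains the thresholded
  matrix (\<open>prox_on_norm12\<close>).

  Thresholding rescales each row, so it is multiplication from the left by a diagonal matrix and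
  cannot raise the rank (\<open>rank_soft_threshold_le\<close>). This keeps the unconstrained minimizer inside
  the set of matrices of rank at most \<open>k\<close> when \<open>Y\<close> lies there.
\<close>

lemma row_eq_nth: "row i X = X $ i"
  by (simp add: row_def vec_eq_iff)

lemma norm_sq_sum_rows:
  fixes X :: "real^'n^'m"
  shows "(norm X)\<^sup>2 = (\<Sum>i\<in>UNIV. (norm (X $ i))\<^sup>2)"
  by (simp add: norm_vec_def L2_set_def sum_nonneg)

text \<open>
  The next two lemmas say that the residual is a subgradient of \<open>\<mu> * norm\<close> at the thresholded row:
  it is \<open>\<mu>\<close> times the unit vector along \<open>y\<close> if the row survives, and \<open>y\<close> itself, a vector
  of norm at most \<open>\<mu>\<close>, if the row is set to zero.
\<close>

lemma norm_soft_threshold_row_residual_le: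
  assumes "\<mu> > 0"
  shows "norm (y - soft_threshold_row \<mu> y) \<le> \<mu>"
proof (cases "norm y > \<mu>")
  case True
  with assms have "norm y > 0" by linarith
  have "y - soft_threshold_row \<mu> y = (1 - (norm y - \<mu>) / norm y) *\<^sub>R y"
    using True by (simp add: soft_threshold_row_def scaleR_left_diff_distrib)
  also have "1 - (norm y - \<mu>) / norm y = \<mu> / norm y"
    using \<open>norm y > 0\<close> by (simp add: field_simps)
  finally show ?thesis
    using \<open>norm y > 0\<close> assms by simp
next
  case False
  then show ?thesis by (simp add: soft_threshold_row_def)
qed

lemma inner_soft_threshold_row_residual:
  assumes "\<mu> > 0"
  shows "(y - soft_threshold_row \<mu> y) \<bullet> soft_threshold_row \<mu> y = \<mu> * norm (soft_threshold_row \<mu> y)"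
proof (cases "norm y > \<mu>")
  case True
  with assms have pos: "norm y > 0" by linarith
  define c where "c = (norm y - \<mu>) / norm y"
  have s: "soft_threshold_row \<mu> y = c *\<^sub>R y"
    using True by (simp add: soft_threshold_row_def c_def)
  have c: "c \<ge> 0" "(1 - c) * norm y = \<mu>"
    using True pos by (auto simp: c_def field_simps)
  have "(y - c *\<^sub>R y) \<bullet> (c *\<^sub>R y) = ((1 - c) * norm y) * (c * norm y)"
    by (simp add: inner_diff_left dot_square_norm power2_eq_square algebra_simps)
  then show ?thesis
    using c by (simp add: s)
next
  case False
  then show ?thesis by (simp add: soft_threshold_row_def)
qed

text \<open>
  With \<open>s\<close> the thresholded row and \<open>g = y - s\<close>, expanding \<open>(norm (x - y))\<^sup>2\<close> around \<open>s\<close> leaves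
  exactly \<open>\<mu> * norm x - x \<bullet> g\<close> as the difference of the two sides, because
  \<open>g \<bullet> s = \<mu> * norm s\<close>. It is nonnegative by Cauchy-Schwarz and \<open>norm g \<le> \<mu>\<close>.
\<close>

lemma row_objective_quadratic_growth:
  fixes x y :: "real^'n" and \<mu> :: real
  assumes "\<mu> > 0"
  defines "s \<equiv> soft_threshold_row \<mu> y"
  shows "\<mu> * norm s + 1/2 * (norm (s - y))\<^sup>2 + 1/2 * (norm (x - s))\<^sup>2
    \<le> \<mu> * norm x + 1/2 * (norm (x - y))\<^sup>2"
proof -
  have expand: "(norm (x - y))\<^sup>2
      = (norm (x - s))\<^sup>2 + (norm (s - y))\<^sup>2 - 2 * (x \<bullet> (y - s)) + 2 * ((y - s) \<bullet> s)"
    unfolding power2_norm_eq_inner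
    by (simp add: inner_diff_left inner_diff_right inner_commute algebra_simps)
  have "x \<bullet> (y - s) \<le> norm x * norm (y - s)"
    by (rule norm_cauchy_schwarz)
  also have "\<dots> \<le> norm x * \<mu>"
    unfolding s_def by (intro mult_left_mono norm_soft_threshold_row_residual_le assms(1) norm_ge_zero)
  finally have "x \<bullet> (y - s) \<le> \<mu> * norm x"
    by (simp add: mult.commute)
  moreover have "(y - s) \<bullet> s = \<mu> * norm s"
    unfolding s_def by (rule inner_soft_threshold_row_residual[OF assms(1)])
  ultimately show ?thesis
    using expand by argo
qed

lemma matrix_objective_quadratic_growth:
  fixes X Y :: "real^'n^'m" and \<mu> :: real
  assumes "\<mu> > 0"
  defines "S \<equiv> soft_threshold \<mu> Y"
  shows "\<mu> * norm12 S + 1/2 * (norm (S - Y))\<^sup>2 + 1/2 * (norm (X - S))\<^sup>2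
    \<le> \<mu> * norm12 X + 1/2 * (norm (X - Y))\<^sup>2"
proof -
  have S: "S $ i = soft_threshold_row \<mu> (Y $ i)" for i
    by (simp add: S_def soft_threshold_def row_eq_nth)
  have "(\<Sum>i\<in>UNIV. \<mu> * norm (S $ i) + 1/2 * (norm (S $ i - Y $ i))\<^sup>2
          + 1/2 * (norm (X $ i - S $ i))\<^sup>2)
      \<le> (\<Sum>i\<in>UNIV. \<mu> * norm (X $ i) + 1/2 * (norm (X $ i - Y $ i))\<^sup>2)"
    unfolding S by (intro sum_mono row_objective_quadratic_growth assms(1))
  then show ?thesis
    by (simp only: norm12_def norm_sq_sum_rows row_eq_nth vector_minus_component
        sum.distrib sum_distrib_left)
qed

text \<open>
  The constraint set \<open>A\<close> is arbitrary: the quadratic growth holds against all matrices, so the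
  unconstrained minimizer remains the only minimizer on every set that contains it.
\<close>

lemma prox_on_norm12:
  fixes Y :: "real^'n^'m"
  assumes "\<mu> > 0" and "soft_threshold \<mu> Y \<in> A"
  shows "prox_on A (\<lambda>X. \<mu> * norm12 X) Y = {soft_threshold \<mu> Y}"
proof -
  define S where "S = soft_threshold \<mu> Y"
  define F where "F = (\<lambda>X. \<mu> * norm12 X + 1/2 * (norm (X - Y))\<^sup>2)"
  have growth: "F S + 1/2 * (norm (X - S))\<^sup>2 \<le> F X" for X
    unfolding F_def S_def by (rule matrix_objective_quadratic_growth[OF assms(1)])
  have "S \<in> A"
    using assms(2) by (simp add: S_def)
  have min: "F S \<le> F X" for X
    using growth[of X] zero_le_power2[of "norm (X - S)"] by linarith
  have unique: "X = S" if "F X \<le> F S" for X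
  proof -
    have "(norm (X - S))\<^sup>2 \<le> 0"
      using growth[of X] that by linarith
    then show ?thesis by simp
  qed
  have "{X. is_arg_min F (\<lambda>Z. Z \<in> A) X} = {S}"
    using \<open>S \<in> A\<close> min unique by (auto simp: is_arg_min_linorder)
  then show ?thesis
    by (simp add: prox_on_def F_def S_def)
qed

text \<open>
  Each row of the thresholded matrix is a multiple of the same row of \<open>Y\<close>, so the row space can
  only shrink.
\<close>

lemma rank_soft_threshold_le:
  fixes Y :: "real^'n^'m"
  shows "rank (soft_threshold \<mu> Y) \<le> rank Y"
proof -
  define d where "d i = (if norm (Y $ i) > \<mu> then (norm (Y $ i) - \<mu>) / norm (Y $ i) else 0)" for i
  define D :: "real^'m^'m" where "D = (\<chi> i j. if i = j then d i else 0)"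
  have "soft_threshold \<mu> Y = D ** Y"
    by (simp add: vec_eq_iff matrix_matrix_mult_def D_def d_def soft_threshold_def
        soft_threshold_row_def row_eq_nth if_distrib[where f = "\<lambda>a. a * _"] cong: if_cong)
  then show ?thesis
    by (simp add: rank_mul_le_right)
qed

theorem proposition3p4:
  fixes Y :: "real^'n^'m" and \<mu> :: real and k :: nat
  assumes "\<mu> > 0" and "k \<ge> 1"
  shows "prox_on UNIV (\<lambda>X. \<mu> * norm12 X) Y = {soft_threshold \<mu> Y}
    \<and> (Y \<in> rank_le k \<longrightarrow>
         prox_on (rank_le k) (\<lambda>X. \<mu> * norm12 X) Y = {soft_threshold \<mu> Y})"
proof (intro conjI impI)
  show "prox_on UNIV (\<lambda>X. \<mu> * norm12 X) Y = {soft_threshold \<mu> Y}"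
    by (intro prox_on_norm12 assms(1) UNIV_I)
next
  assume "Y \<in> rank_le k"
  then have "soft_threshold \<mu> Y \<in> rank_le k"
    using rank_soft_threshold_le[of \<mu> Y] by (simp add: rank_le_def)
  then show "prox_on (rank_le k) (\<lambda>X. \<mu> * norm12 X) Y = {soft_threshold \<mu> Y}"
    by (intro prox_on_norm12 assms(1))
qed

end
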